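(* Let $n\ge 1$ be an integer. Uniformly over all prime powers $q$, all nonzero matrices $U\in \mathrm{M}_n(\mathbb{F}_q)$ and all nontrivial additive characters $\lambda$ of $\mathbb{F}_q$, we have $$G_{\mathrm{GL}_n(\mathbb{F}_q)}(U,\lambda)=O(q^{n^2-n}),$$ where the implied constant depends only on $n$. That is, for each $n\ge1$ there is a constant $C_n>0$ such that $|G_{\mathrm{GL}_n(\mathbb{F}_q)}(U,\lambda)|\le C_n\, q^{n^2-n}$ for all such $q$, $U$, $\lambda$.
   Context: $\mathrm{M}_n(\mathbb{F}_q)$ is the set of $n\times n$ matrices over $\mathbb{F}_q$. For $U=(u_{ij}),V=(v_{ij})\in \mathrm{M}_n(\mathbb{F}_q)$, put $U\cdot V=\sum_{1\le i,j\le n}u_{ij}v_{ij}\in \mathbb{F}_q$ (entrywise product summed, not matrix multiplication). An additive character is a homomorphism $(\mathbb{F}_q,+)\to\mathbb{C}^*$. Define $$G_{\mathrm{GL}_n(\mathbb{F}_q)}(U,\lambda)=\sum_{X\in \mathrm{GL}_n(\mathbb{F}_q)}\lambda(U\cdot X).$$ *)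

theory Defs
  imports Complex_Main "HOL-Algebra.Algebra"
begin

text \<open>Finite fields are structures of HOL-Algebra rather than types of class \<open>field\<close>, so that
  a constant can be chosen before the field is. Every finite field has an isomorphic copy with
  carrier in \<open>nat\<close>, so quantifying over \<open>nat ring\<close> already covers all prime powers.\<close>

definition mat_index :: "nat \<Rightarrow> (nat \<times> nat) set" where
  "mat_index n = {..<n} \<times> {..<n}"

definition mat_ring :: "nat \<Rightarrow> ('a, 'm) ring_scheme \<Rightarrow> (nat \<times> nat \<Rightarrow> 'a) ring" where
  "mat_ring n R =
    \<lparr>carrier = mat_index n \<rightarrow>\<^sub>E carrier R,
     monoid.mult = (\<lambda>A B. \<lambda>(i, j)\<in>mat_index n. \<Oplus>\<^bsub>R\<^esub>k\<in>{..<n}. A (i, k) \<otimes>\<^bsub>R\<^esub> B (k, j)),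
     one = (\<lambda>(i, j)\<in>mat_index n. if i = j then \<one>\<^bsub>R\<^esub> else \<zero>\<^bsub>R\<^esub>),
     ring.zero = (\<lambda>p\<in>mat_index n. \<zero>\<^bsub>R\<^esub>),
     ring.add = (\<lambda>A B. \<lambda>p\<in>mat_index n. A p \<oplus>\<^bsub>R\<^esub> B p)\<rparr>"

definition GL :: "nat \<Rightarrow> ('a, 'm) ring_scheme \<Rightarrow> (nat \<times> nat \<Rightarrow> 'a) set" where
  "GL n R = Units (mat_ring n R)"

definition mat_dot ::
    "nat \<Rightarrow> ('a, 'm) ring_scheme \<Rightarrow> (nat \<times> nat \<Rightarrow> 'a) \<Rightarrow> (nat \<times> nat \<Rightarrow> 'a) \<Rightarrow> 'a" where
  "mat_dot n R U V = (\<Oplus>\<^bsub>R\<^esub>p\<in>mat_index n. U p \<otimes>\<^bsub>R\<^esub> V p)"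

definition complex_mult_group :: "complex monoid" where
  "complex_mult_group = \<lparr>carrier = UNIV - {0}, monoid.mult = (*), one = 1\<rparr>"

definition additive_character :: "('a, 'm) ring_scheme \<Rightarrow> ('a \<Rightarrow> complex) \<Rightarrow> bool" where
  "additive_character R \<chi> \<longleftrightarrow> \<chi> \<in> hom (add_monoid R) complex_mult_group"

definition nontrivial_character :: "('a, 'm) ring_scheme \<Rightarrow> ('a \<Rightarrow> complex) \<Rightarrow> bool" where
  "nontrivial_character R \<chi> \<longleftrightarrow> (\<exists>x\<in>carrier R. \<chi> x \<noteq> 1)"

definition GL_gauss_sum ::
    "nat \<Rightarrow> ('a, 'm) ring_scheme \<Rightarrow> (nat \<times> nat \<Rightarrow> 'a) \<Rightarrow> ('a \<Rightarrow> complex) \<Rightarrow> complex" where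
  "GL_gauss_sum n R U \<chi> = (\<Sum>A\<in>GL n R. \<chi> (mat_dot n R U A))"

end

theory Submission
  imports Defs
begin

text \<open>Choose a column j in which U is nonzero. Right multiplication by the invertible matrices that
  differ from the identity in column j only permutes the general linear group, so the Gauss sum
  does not change if it is averaged over these matrices. With w = (row vector of column j of U) A,
  which is nonzero for invertible A, the inner average at A factors into one-variable
  character sums: it vanishes unless w is supported at j, and otherwise has modulus 1/(q-1).
  The condition that w be supported at j imposes one linear equation on each column of A other
  than the j-th, which leaves at most q^(n^2-n+1) matrices.\<close>

section \<open>Interchange of finite sums and finiteness of the index set\<close>

lemma (in abelian_monoid) finsum_swap:
  assumes "finite A" "finite B" "\<And>x y. x \<in> A \<Longrightarrow> y \<in> B \<Longrightarrow> f x y \<in> carrier G"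
  shows "(\<Oplus>x\<in>A. \<Oplus>y\<in>B. f x y) = (\<Oplus>y\<in>B. \<Oplus>x\<in>A. f x y)"
  using assms(1,3)
proof (induction A)
  case empty
  then show ?case by simp
next
  case (insert a A)
  have "(\<Oplus>y\<in>B. \<Oplus>x\<in>insert a A. f x y) = (\<Oplus>y\<in>B. f a y \<oplus> (\<Oplus>x\<in>A. f x y))"
    by (rule finsum_cong') (use insert in \<open>auto simp: Pi_def\<close>)
  also have "\<dots> = (\<Oplus>y\<in>B. f a y) \<oplus> (\<Oplus>y\<in>B. \<Oplus>x\<in>A. f x y)"
    by (rule finsum_addf) (use insert in auto)
  finally show ?case
    using insert by (simp add: Pi_def)
qed

lemma finite_mat_index: "finite (mat_index n)"
  by (simp add: mat_index_def)

section \<open>The monoid of matrices\<close>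

lemma mat_carrierD:
  "A \<in> carrier (mat_ring n R) \<Longrightarrow> i < n \<Longrightarrow> j < n \<Longrightarrow> A (i, j) \<in> carrier R"
  by (auto simp: mat_ring_def mat_index_def)

lemma mat_carrierI:
  "(\<And>i j. i < n \<Longrightarrow> j < n \<Longrightarrow> f (i, j) \<in> carrier R) \<Longrightarrow>
    restrict f (mat_index n) \<in> carrier (mat_ring n R)"
  by (auto simp: mat_ring_def mat_index_def)

lemma mat_eqI:
  assumes "A \<in> carrier (mat_ring n R)" "Y \<in> carrier (mat_ring n R)"
    and "\<And>i j. i < n \<Longrightarrow> j < n \<Longrightarrow> A (i, j) = Y (i, j)"
  shows "A = Y"
  using assms by (intro PiE_ext[where k = "mat_index n"]) (auto simp: mat_ring_def mat_index_def)

lemma mat_mult_nth: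
  "i < n \<Longrightarrow> j < n \<Longrightarrow>
    (A \<otimes>\<^bsub>mat_ring n R\<^esub> Y) (i, j) = (\<Oplus>\<^bsub>R\<^esub>k\<in>{..<n}. A (i, k) \<otimes>\<^bsub>R\<^esub> Y (k, j))"
  by (simp add: mat_ring_def mat_index_def)

lemma mat_one_nth:
  "i < n \<Longrightarrow> j < n \<Longrightarrow> \<one>\<^bsub>mat_ring n R\<^esub> (i, j) = (if i = j then \<one>\<^bsub>R\<^esub> else \<zero>\<^bsub>R\<^esub>)"
  by (simp add: mat_ring_def mat_index_def)

lemma finite_mat_carrier: "finite (carrier R) \<Longrightarrow> finite (carrier (mat_ring n R))"
  by (auto simp: mat_ring_def finite_mat_index intro!: finite_PiE)

context ring
begin

lemma mat_mult_closed:
  assumes "A \<in> carrier (mat_ring n R)" "Y \<in> carrier (mat_ring n R)"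
  shows "A \<otimes>\<^bsub>mat_ring n R\<^esub> Y \<in> carrier (mat_ring n R)"
  using mat_carrierD[OF assms(1)] mat_carrierD[OF assms(2)]
  by (auto simp: mat_ring_def mat_index_def intro!: finsum_closed)

lemma mat_one_closed: "\<one>\<^bsub>mat_ring n R\<^esub> \<in> carrier (mat_ring n R)"
  by (auto simp: mat_ring_def mat_index_def)

text \<open>Interchanging the two sums gives (a A) Y = a (A Y) for a row vector a. It serves twice:
  with a row of a matrix as a it yields associativity of the matrix product, and with arbitrary a it
  lets an invertible matrix be cancelled.\<close>

lemma vec_mat_assoc:
  assumes "\<And>i. i < n \<Longrightarrow> a i \<in> carrier R"
    and A: "A \<in> carrier (mat_ring n R)" and Y: "Y \<in> carrier (mat_ring n R)" and "k < n"
  shows "(\<Oplus>l\<in>{..<n}. (\<Oplus>i\<in>{..<n}. a i \<otimes> A (i, l)) \<otimes> Y (l, k)) =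
    (\<Oplus>i\<in>{..<n}. a i \<otimes> (\<Oplus>l\<in>{..<n}. A (i, l) \<otimes> Y (l, k)))"
proof -
  note [simp] = assms(1) mat_carrierD[OF A] mat_carrierD[OF Y] \<open>k < n\<close>
  have "(\<Oplus>l\<in>{..<n}. (\<Oplus>i\<in>{..<n}. a i \<otimes> A (i, l)) \<otimes> Y (l, k)) =
      (\<Oplus>l\<in>{..<n}. \<Oplus>i\<in>{..<n}. a i \<otimes> A (i, l) \<otimes> Y (l, k))"
    by (rule finsum_cong') (auto intro!: finsum_ldistr finsum_closed)
  also have "\<dots> = (\<Oplus>i\<in>{..<n}. \<Oplus>l\<in>{..<n}. a i \<otimes> A (i, l) \<otimes> Y (l, k))"
    by (rule finsum_swap) auto
  also have "\<dots> = (\<Oplus>i\<in>{..<n}. \<Oplus>l\<in>{..<n}. a i \<otimes> (A (i, l) \<otimes> Y (l, k)))"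
    by (intro finsum_cong') (auto intro!: finsum_closed simp: m_assoc)
  also have "\<dots> = (\<Oplus>i\<in>{..<n}. a i \<otimes> (\<Oplus>l\<in>{..<n}. A (i, l) \<otimes> Y (l, k)))"
    by (rule finsum_cong') (auto intro!: finsum_rdistr[symmetric] finsum_closed)
  finally show ?thesis .
qed

lemma finsum_mult_delta:
  fixes n :: nat
  assumes "j < n" "\<And>i. i < n \<Longrightarrow> a i \<in> carrier R"
  shows "(\<Oplus>i\<in>{..<n}. a i \<otimes> (if i = j then \<one> else \<zero>)) = a j"
proof -
  have "(\<Oplus>i\<in>{..<n}. a i \<otimes> (if i = j then \<one> else \<zero>)) =
      (\<Oplus>i\<in>{..<n}. if i = j then a i else \<zero>)"
    by (rule finsum_cong') (use assms in auto)
  also have "\<dots> = a j"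
    by (rule add.finprod_singleton_swap) (use assms in auto)
  finally show ?thesis .
qed

lemma finsum_delta_mult:
  fixes n :: nat
  assumes "j < n" "\<And>i. i < n \<Longrightarrow> a i \<in> carrier R"
  shows "(\<Oplus>i\<in>{..<n}. (if j = i then \<one> else \<zero>) \<otimes> a i) = a j"
proof -
  have "(\<Oplus>i\<in>{..<n}. (if j = i then \<one> else \<zero>) \<otimes> a i) =
      (\<Oplus>i\<in>{..<n}. if j = i then a i else \<zero>)"
    by (rule finsum_cong') (use assms in auto)
  also have "\<dots> = a j"
    by (rule finsum_singleton) (use assms in auto)
  finally show ?thesis .
qed

text \<open>Makes \<open>GL n R\<close> the unit group of a monoid, so that translation by units is
  available for the averaging.\<close>

lemma mat_monoid: "monoid (mat_ring n R)"
proof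
  fix A Y assume XY: "A \<in> carrier (mat_ring n R)" "Y \<in> carrier (mat_ring n R)"
  show "A \<otimes>\<^bsub>mat_ring n R\<^esub> Y \<in> carrier (mat_ring n R)"
    using XY by (rule mat_mult_closed)
  fix Z assume Z: "Z \<in> carrier (mat_ring n R)"
  show "A \<otimes>\<^bsub>mat_ring n R\<^esub> Y \<otimes>\<^bsub>mat_ring n R\<^esub> Z = A \<otimes>\<^bsub>mat_ring n R\<^esub> (Y \<otimes>\<^bsub>mat_ring n R\<^esub> Z)"
  proof (rule mat_eqI[where R = R])
    fix i j assume ij: "i < n" "j < n"
    have "(A \<otimes>\<^bsub>mat_ring n R\<^esub> Y \<otimes>\<^bsub>mat_ring n R\<^esub> Z) (i, j) =
        (\<Oplus>l\<in>{..<n}. (\<Oplus>k\<in>{..<n}. A (i, k) \<otimes> Y (k, l)) \<otimes> Z (l, j))"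
      unfolding mat_mult_nth[OF ij]
      by (rule finsum_cong')
        (use ij XY Z in \<open>auto simp: mat_mult_nth intro!: finsum_closed m_closed dest: mat_carrierD\<close>)
    \<comment> \<open>This is \<open>vec_mat_assoc\<close> with row i of A as the vector.\<close>
    also have "\<dots> = (\<Oplus>k\<in>{..<n}. A (i, k) \<otimes> (\<Oplus>l\<in>{..<n}. Y (k, l) \<otimes> Z (l, j)))"
      by (rule vec_mat_assoc) (use ij XY Z in \<open>auto dest: mat_carrierD\<close>)
    also have "\<dots> = (A \<otimes>\<^bsub>mat_ring n R\<^esub> (Y \<otimes>\<^bsub>mat_ring n R\<^esub> Z)) (i, j)"
      unfolding mat_mult_nth[OF ij]
      by (rule finsum_cong')
        (use ij XY Z in \<open>auto simp: mat_mult_nth intro!: finsum_closed m_closed dest: mat_carrierD\<close>)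
    finally show "(A \<otimes>\<^bsub>mat_ring n R\<^esub> Y \<otimes>\<^bsub>mat_ring n R\<^esub> Z) (i, j) =
      (A \<otimes>\<^bsub>mat_ring n R\<^esub> (Y \<otimes>\<^bsub>mat_ring n R\<^esub> Z)) (i, j)" .
  qed (intro mat_mult_closed XY Z)+
next
  show "\<one>\<^bsub>mat_ring n R\<^esub> \<in> carrier (mat_ring n R)"
    by (rule mat_one_closed)
next
  fix A assume A: "A \<in> carrier (mat_ring n R)"
  note c = mat_carrierD[OF A]
  show "\<one>\<^bsub>mat_ring n R\<^esub> \<otimes>\<^bsub>mat_ring n R\<^esub> A = A"
  proof (rule mat_eqI[where R = R])
    fix i j assume ij: "i < n" "j < n"
    have "(\<one>\<^bsub>mat_ring n R\<^esub> \<otimes>\<^bsub>mat_ring n R\<^esub> A) (i, j) =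
        (\<Oplus>k\<in>{..<n}. (if i = k then \<one> else \<zero>) \<otimes> A (k, j))"
      unfolding mat_mult_nth[OF ij] by (rule finsum_cong') (use ij c in \<open>auto simp: mat_one_nth\<close>)
    then show "(\<one>\<^bsub>mat_ring n R\<^esub> \<otimes>\<^bsub>mat_ring n R\<^esub> A) (i, j) = A (i, j)"
      using finsum_delta_mult[of i n "\<lambda>k. A (k, j)"] c ij by simp
  qed (intro mat_mult_closed mat_one_closed A)+
  show "A \<otimes>\<^bsub>mat_ring n R\<^esub> \<one>\<^bsub>mat_ring n R\<^esub> = A"
  proof (rule mat_eqI[where R = R])
    fix i j assume ij: "i < n" "j < n"
    have "(A \<otimes>\<^bsub>mat_ring n R\<^esub> \<one>\<^bsub>mat_ring n R\<^esub>) (i, j) =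
        (\<Oplus>k\<in>{..<n}. A (i, k) \<otimes> (if k = j then \<one> else \<zero>))"
      unfolding mat_mult_nth[OF ij] by (rule finsum_cong') (use ij c in \<open>auto simp: mat_one_nth\<close>)
    then show "(A \<otimes>\<^bsub>mat_ring n R\<^esub> \<one>\<^bsub>mat_ring n R\<^esub>) (i, j) = A (i, j)"
      using finsum_mult_delta[of j n "\<lambda>k. A (i, k)"] c ij by simp
  qed (intro mat_mult_closed mat_one_closed A)+
qed

text \<open>With a right inverse Y of A one has (u A) Y = u, so u A = 0 would force
  \<open>u k\<close> to vanish. Only column k of Y enters the computation.\<close>

lemma GL_vec_mult_nonzero:
  assumes A: "A \<in> GL n R" and u: "\<And>i. i < n \<Longrightarrow> u i \<in> carrier R"
    and "k < n" "u k \<noteq> \<zero>"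
  shows "\<exists>l<n. (\<Oplus>i\<in>{..<n}. u i \<otimes> A (i, l)) \<noteq> \<zero>"
proof (rule ccontr)
  assume contr: "\<not> ?thesis"
  obtain Y where A: "A \<in> carrier (mat_ring n R)" and Y: "Y \<in> carrier (mat_ring n R)"
    and XY: "A \<otimes>\<^bsub>mat_ring n R\<^esub> Y = \<one>\<^bsub>mat_ring n R\<^esub>"
    using A by (auto simp: GL_def Units_def)
  note c = mat_carrierD[OF A] mat_carrierD[OF Y]
  have *: "(\<Oplus>l\<in>{..<n}. A (i, l) \<otimes> Y (l, k)) = (if i = k then \<one> else \<zero>)" if "i < n" for i
    using arg_cong[OF XY, of "\<lambda>Z. Z (i, k)"] that \<open>k < n\<close> by (simp add: mat_mult_nth mat_one_nth)
  have "(\<Oplus>l\<in>{..<n}. (\<Oplus>i\<in>{..<n}. u i \<otimes> A (i, l)) \<otimes> Y (l, k)) = \<zero>"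
    by (rule add.finprod_one_eqI) (use contr c \<open>k < n\<close> in auto)
  moreover have "(\<Oplus>l\<in>{..<n}. (\<Oplus>i\<in>{..<n}. u i \<otimes> A (i, l)) \<otimes> Y (l, k)) =
      (\<Oplus>i\<in>{..<n}. u i \<otimes> (\<Oplus>l\<in>{..<n}. A (i, l) \<otimes> Y (l, k)))"
    by (rule vec_mat_assoc) (use u A Y \<open>k < n\<close> in auto)
  moreover have "\<dots> = (\<Oplus>i\<in>{..<n}. u i \<otimes> (if i = k then \<one> else \<zero>))"
    by (rule finsum_cong') (use * u in auto)
  moreover have "\<dots> = u k"
    using u \<open>k < n\<close> by (intro finsum_mult_delta) auto
  ultimately show False
    using \<open>u k \<noteq> \<zero>\<close> by simp
qed

end

section \<open>The identity matrix with one column replaced\<close>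

definition col_mat :: "nat \<Rightarrow> ('a, 'm) ring_scheme \<Rightarrow> nat \<Rightarrow> (nat \<Rightarrow> 'a) \<Rightarrow> nat \<times> nat \<Rightarrow> 'a" where
  "col_mat n R j v =
    (\<lambda>(i, k)\<in>mat_index n. if k = j then v i else if i = k then \<one>\<^bsub>R\<^esub> else \<zero>\<^bsub>R\<^esub>)"

lemma col_mat_nth:
  "i < n \<Longrightarrow> k < n \<Longrightarrow>
    col_mat n R j v (i, k) = (if k = j then v i else if i = k then \<one>\<^bsub>R\<^esub> else \<zero>\<^bsub>R\<^esub>)"
  by (simp add: col_mat_def mat_index_def)

context ring
begin

lemma col_mat_closed:
  "(\<And>i. i < n \<Longrightarrow> v i \<in> carrier R) \<Longrightarrow> col_mat n R j v \<in> carrier (mat_ring n R)"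
  unfolding col_mat_def by (rule mat_carrierI) auto

text \<open>Every column of \<open>col_mat n R j v\<close> other than the j-th is a unit vector, so
  right multiplication changes only column j, which becomes A v.\<close>

lemma mult_col_mat_nth:
  assumes A: "A \<in> carrier (mat_ring n R)" and v: "\<And>i. i < n \<Longrightarrow> v i \<in> carrier R"
    and ik: "i < n" "k < n"
  shows "(A \<otimes>\<^bsub>mat_ring n R\<^esub> col_mat n R j v) (i, k) =
    (if k = j then (\<Oplus>l\<in>{..<n}. A (i, l) \<otimes> v l) else A (i, k))"
proof -
  note c = mat_carrierD[OF A]
  show ?thesis
  proof (cases "k = j")
    case True
    then show ?thesis
      unfolding mat_mult_nth[OF ik] using ik c v by (auto intro!: finsum_cong' simp: col_mat_nth)
  next
    case False
    have "(A \<otimes>\<^bsub>mat_ring n R\<^esub> col_mat n R j v) (i, k) =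
        (\<Oplus>l\<in>{..<n}. A (i, l) \<otimes> (if l = k then \<one> else \<zero>))"
      unfolding mat_mult_nth[OF ik]
      by (rule finsum_cong') (use False ik c in \<open>auto simp: col_mat_nth\<close>)
    then show ?thesis
      using False finsum_mult_delta[of k n "\<lambda>l. A (i, l)"] c ik by simp
  qed
qed

end

context field
begin

text \<open>The two equations are exactly those for column j of the product; the other columns are
  unit vectors already. Covering one order of the factors lets the same lemma check a two-sided
  inverse by exchanging v and v'.\<close>

lemma col_mat_mult_eq_one:
  assumes v: "\<And>i. i < n \<Longrightarrow> v i \<in> carrier R" and v': "\<And>i. i < n \<Longrightarrow> v' i \<in> carrier R"
    and j: "j < n" "v j \<otimes> v' j = \<one>"
    and z: "\<And>i. i < n \<Longrightarrow> i \<noteq> j \<Longrightarrow> v i \<otimes> v' j \<oplus> v' i = \<zero>"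
  shows "col_mat n R j v \<otimes>\<^bsub>mat_ring n R\<^esub> col_mat n R j v' = \<one>\<^bsub>mat_ring n R\<^esub>"
proof (rule mat_eqI[where R = R])
  note cl = col_mat_closed[of n v j, OF v] col_mat_closed[of n v' j, OF v']
  show "col_mat n R j v \<otimes>\<^bsub>mat_ring n R\<^esub> col_mat n R j v' \<in> carrier (mat_ring n R)"
    by (intro mat_mult_closed cl)
  fix i k assume ik: "i < n" "k < n"
  show "(col_mat n R j v \<otimes>\<^bsub>mat_ring n R\<^esub> col_mat n R j v') (i, k) = \<one>\<^bsub>mat_ring n R\<^esub> (i, k)"
  proof (cases "k = j")
    case False
    then show ?thesis
      using ik by (simp add: mult_col_mat_nth[OF cl(1) v'] col_mat_nth mat_one_nth)
  next
    case True
    \<comment> \<open>Row i of the first factor is \<open>v i\<close> at position j plus a unit at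
      position i. For i = j that unit has been overwritten by v, so the second summand is set to
      zero there.\<close>
    have "(\<Oplus>l\<in>{..<n}. col_mat n R j v (i, l) \<otimes> v' l) =
        (\<Oplus>l\<in>{..<n}. (if l = j then v i \<otimes> v' l else \<zero>) \<oplus>
          (if i = l then (if i = j then \<zero> else v' l) else \<zero>))"
      by (rule finsum_cong') (use ik v v' in \<open>auto simp: col_mat_nth\<close>)
    also have "\<dots> = (\<Oplus>l\<in>{..<n}. if l = j then v i \<otimes> v' l else \<zero>) \<oplus>
          (\<Oplus>l\<in>{..<n}. if i = l then (if i = j then \<zero> else v' l) else \<zero>)"
      by (rule finsum_addf) (use ik v v' in auto)
    also have "(\<Oplus>l\<in>{..<n}. if l = j then v i \<otimes> v' l else \<zero>) = v i \<otimes> v' j"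
      by (rule add.finprod_singleton_swap) (use ik v v' j in auto)
    also have "(\<Oplus>l\<in>{..<n}. if i = l then (if i = j then \<zero> else v' l) else \<zero>) =
        (if i = j then \<zero> else v' i)"
      by (rule finsum_singleton) (use ik v v' j in auto)
    finally show ?thesis
      using True ik j z v v' by (auto simp: mult_col_mat_nth[OF cl(1) v'] mat_one_nth)
  qed
qed (rule mat_one_closed)

text \<open>The inverse is again an identity matrix with column j replaced. This supplies the
  invertible matrices used for averaging.\<close>

lemma col_mat_GL:
  assumes v: "\<And>i. i < n \<Longrightarrow> v i \<in> carrier R" and j: "j < n" "v j \<noteq> \<zero>"
  shows "col_mat n R j v \<in> GL n R"
proof -
  \<comment> \<open>The solution of the equations in \<open>col_mat_mult_eq_one\<close>: 1 / v_j at
    j and - v_i / v_j elsewhere.\<close>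
  define v' where "v' = (\<lambda>i. if i = j then inv (v j) else \<ominus> (v i \<otimes> inv (v j)))"
  have vj: "v j \<in> Units R"
    using v j field_Units by auto
  then have inv: "inv (v j) \<in> carrier R" "v j \<otimes> inv (v j) = \<one>" "inv (v j) \<otimes> v j = \<one>"
    by auto
  have v': "v' i \<in> carrier R" if "i < n" for i
    using v[OF that] inv by (auto simp: v'_def)
  have "v' i \<otimes> v j \<oplus> v i = \<zero>" if "i < n" "i \<noteq> j" for i
  proof -
    have "v' i \<otimes> v j = \<ominus> v i"
      using that v[OF that(1)] v[OF j(1)] inv by (simp add: v'_def l_minus m_assoc)
    then show ?thesis
      using v[OF that(1)] by (simp add: l_neg)
  qed
  moreover have "v i \<otimes> v' j \<oplus> v' i = \<zero>" if "i < n" "i \<noteq> j" for i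
    using that v[OF that(1)] inv by (simp add: v'_def r_neg)
  ultimately have "col_mat n R j v \<otimes>\<^bsub>mat_ring n R\<^esub> col_mat n R j v' = \<one>\<^bsub>mat_ring n R\<^esub>"
    "col_mat n R j v' \<otimes>\<^bsub>mat_ring n R\<^esub> col_mat n R j v = \<one>\<^bsub>mat_ring n R\<^esub>"
    using inv v v' j by (intro col_mat_mult_eq_one; simp add: v'_def)+
  then show ?thesis
    using col_mat_closed[of n v j] col_mat_closed[of n v' j] v v'
    unfolding GL_def Units_def by blast
qed

end

text \<open>Right translation by g permutes the units, with translation by the inverse of g undoing
  it; hence the Gauss sum is invariant under it.\<close>

lemma (in monoid) sum_Units_mult_right:
  assumes "g \<in> Units G"
  shows "(\<Sum>x\<in>Units G. f (x \<otimes> g)) = (\<Sum>x\<in>Units G. f x)"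
proof (rule sum.reindex_bij_witness[where i = "\<lambda>x. x \<otimes> inv g" and j = "\<lambda>x. x \<otimes> g"])
qed (use assms in \<open>auto simp: m_assoc Units_closed\<close>)

section \<open>Additive characters\<close>

locale finite_field_character = field R for R (structure) +
  fixes \<chi> :: "'a \<Rightarrow> complex"
  assumes finite_carrier: "finite (carrier R)"
    and character: "additive_character R \<chi>"
    and nontrivial: "nontrivial_character R \<chi>"
begin

lemma character_nonzero: "x \<in> carrier R \<Longrightarrow> \<chi> x \<noteq> 0"
  using character by (auto simp: additive_character_def hom_def complex_mult_group_def Pi_def)

lemma character_add:
  "x \<in> carrier R \<Longrightarrow> y \<in> carrier R \<Longrightarrow> \<chi> (x \<oplus> y) = \<chi> x * \<chi> y"
  using character by (auto simp: additive_character_def hom_def complex_mult_group_def)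

lemma character_zero: "\<chi> \<zero> = 1"
  using character_add[of \<zero> \<zero>] character_nonzero[of \<zero>] by simp

lemma character_finsum:
  "finite A \<Longrightarrow> (\<And>x. x \<in> A \<Longrightarrow> f x \<in> carrier R) \<Longrightarrow> \<chi> (\<Oplus>x\<in>A. f x) = (\<Prod>x\<in>A. \<chi> (f x))"
  by (induction A rule: finite_induct) (auto simp: character_zero character_add Pi_def)

text \<open>The order q of the additive group annihilates x, so \<open>\<chi> x\<close> is a q-th
  root of unity.\<close>

lemma norm_character:
  assumes "x \<in> carrier R"
  shows "norm (\<chi> x) = 1"
proof -
  have "\<chi> (\<Oplus>y\<in>carrier R. x) = \<chi> x ^ card (carrier R)"
    using assms finite_carrier by (simp add: character_finsum)
  moreover have "(\<Oplus>y\<in>carrier R. x) = \<zero>"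
    using add.power_order_eq_one[OF _ assms] finite_carrier assms
    by (simp add: add.finprod_const)
  ultimately have "norm (\<chi> x) ^ card (carrier R) = 1"
    by (metis character_zero norm_one norm_power)
  moreover have "card (carrier R) > 0"
    using finite_carrier assms by (auto simp: card_gt_0_iff)
  ultimately show ?thesis
    using power_eq_imp_eq_base[of "norm (\<chi> x)" "card (carrier R)" 1] by simp
qed

text \<open>Orthogonality of characters: for nonzero a, a suitable shift of the summation variable
  multiplies the sum by a value other than 1, so the sum is 0.\<close>

lemma sum_character_mult:
  assumes a: "a \<in> carrier R"
  shows "(\<Sum>x\<in>carrier R. \<chi> (a \<otimes> x)) = (if a = \<zero> then of_nat (card (carrier R)) else 0)"
proof (cases "a = \<zero>")
  case True
  then show ?thesis by (simp add: character_zero)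
next
  case False
  obtain y where y: "y \<in> carrier R" "\<chi> y \<noteq> 1"
    using nontrivial by (auto simp: nontrivial_character_def)
  have a': "a \<in> Units R"
    using False a field_Units by auto
  \<comment> \<open>The shift b is chosen so that a b = y, where the character differs from
    1.\<close>
  define b where "b = inv a \<otimes> y"
  have b: "b \<in> carrier R" "a \<otimes> b = y"
    using a a' y by (auto simp: b_def m_assoc[symmetric])
  have "(\<Sum>x\<in>carrier R. \<chi> (a \<otimes> x)) = (\<Sum>x\<in>carrier R. \<chi> (a \<otimes> (b \<oplus> x)))"
    by (rule sum.reindex_bij_witness[where i = "\<lambda>x. b \<oplus> x" and j = "\<lambda>x. \<ominus> b \<oplus> x"])
      (use b in \<open>auto simp: a_assoc[symmetric] l_neg r_neg\<close>)
  also have "\<dots> = \<chi> y * (\<Sum>x\<in>carrier R. \<chi> (a \<otimes> x))"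
    unfolding sum_distrib_left
    by (rule sum.cong) (use a b in \<open>auto simp: r_distr character_add\<close>)
  finally show ?thesis
    using y False by simp
qed

text \<open>The full sum is 0 and the omitted term at zero is 1.\<close>

lemma sum_nonzero_character_mult:
  assumes a: "a \<in> carrier R" "a \<noteq> \<zero>"
  shows "(\<Sum>x\<in>carrier R - {\<zero>}. \<chi> (a \<otimes> x)) = - 1"
  using sum_character_mult[OF a(1)] a finite_carrier
  by (simp add: sum_diff1 character_zero)

text \<open>If w is supported at j, its j-th entry is nonzero, so the j-th factor is -1.\<close>

lemma norm_sum_character_vec:
  assumes w: "\<And>l. l < n \<Longrightarrow> w l \<in> carrier R" and w0: "\<exists>l<n. w l \<noteq> \<zero>" and j: "j < n"
  shows "norm (\<Sum>v\<in>(\<Pi>\<^sub>E l\<in>{..<n}. if l = j then carrier R - {\<zero>} else carrier R).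
      \<Prod>l<n. \<chi> (w l \<otimes> v l)) =
    (if \<forall>l<n. l \<noteq> j \<longrightarrow> w l = \<zero> then real (card (carrier R)) ^ (n - 1) else 0)"
proof -
  define B where "B = (\<lambda>l. if l = j then carrier R - {\<zero>} else carrier R)"
  define S where "S = (\<lambda>l. \<Sum>x\<in>B l. \<chi> (w l \<otimes> x))"
  have S: "S l = (if w l = \<zero> then of_nat (card (carrier R)) else 0)" if "l < n" "l \<noteq> j" for l
    using sum_character_mult[OF w] that by (simp add: S_def B_def)
  \<comment> \<open>The coordinates of v range independently, so distributivity turns the sum of
    products into a product of one-variable sums.\<close>
  have "(\<Sum>v\<in>Pi\<^sub>E {..<n} B. \<Prod>l<n. \<chi> (w l \<otimes> v l)) = (\<Prod>l<n. S l)"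
    unfolding S_def by (rule prod_sum_PiE[symmetric]) (auto simp: B_def finite_carrier)
  also have "\<dots> = S j * (\<Prod>l\<in>{..<n} - {j}. S l)"
    using j by (intro prod.remove) auto
  finally have *: "norm (\<Sum>v\<in>Pi\<^sub>E {..<n} B. \<Prod>l<n. \<chi> (w l \<otimes> v l)) =
      norm (S j) * (\<Prod>l\<in>{..<n} - {j}. norm (S l))"
    by (simp add: norm_mult prod_norm)
  show ?thesis
  proof (cases "\<forall>l<n. l \<noteq> j \<longrightarrow> w l = \<zero>")
    case True
    then have "w j \<noteq> \<zero>"
      using w0 by auto
    then have "norm (S j) = 1"
      using sum_nonzero_character_mult[OF w] j by (simp add: S_def B_def)
    moreover have "(\<Prod>l\<in>{..<n} - {j}. norm (S l)) =
        (\<Prod>l\<in>{..<n} - {j}. real (card (carrier R)))"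
      by (rule prod.cong) (use True S in auto)
    ultimately show ?thesis
      using True * j by (simp add: B_def)
  next
    case False
    \<comment> \<open>A single nonzero \<open>w l\<close> off j makes the full character sum
      \<open>S l\<close> vanish, and with it the whole product.\<close>
    then obtain l where "l < n" "l \<noteq> j" "w l \<noteq> \<zero>"
      by auto
    then have "(\<Prod>l\<in>{..<n} - {j}. norm (S l)) = 0"
      using S by (intro prod_zero) auto
    then show ?thesis
      using False * by (auto simp: B_def)
  qed
qed

section \<open>Averaging the Gauss sum\<close>

text \<open>Separates the dependence on v. The columns of the product other than the j-th are those
  of A and give the first factor, free of v; column j is A v and contributes a linear form in v
  whose coefficients are the row vector (column j of U) A.\<close>

lemma character_mat_dot_mult_col_mat:
  assumes U: "U \<in> carrier (mat_ring n R)" and A: "A \<in> carrier (mat_ring n R)"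
    and v: "\<And>i. i < n \<Longrightarrow> v i \<in> carrier R" and j: "j < n"
  shows "\<chi> (mat_dot n R U (A \<otimes>\<^bsub>mat_ring n R\<^esub> col_mat n R j v)) =
    (\<Prod>i<n. \<Prod>k\<in>{..<n} - {j}. \<chi> (U (i, k) \<otimes> A (i, k))) *
    (\<Prod>l<n. \<chi> ((\<Oplus>i\<in>{..<n}. U (i, j) \<otimes> A (i, l)) \<otimes> v l))"
proof -
  define Y where "Y = A \<otimes>\<^bsub>mat_ring n R\<^esub> col_mat n R j v"
  have Y: "Y \<in> carrier (mat_ring n R)"
    unfolding Y_def by (intro mat_mult_closed A col_mat_closed v)
  note c = mat_carrierD[OF U] mat_carrierD[OF A] mat_carrierD[OF Y]
  have nth: "Y (i, k) = (if k = j then (\<Oplus>l\<in>{..<n}. A (i, l) \<otimes> v l) else A (i, k))"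
    if "i < n" "k < n" for i k
    unfolding Y_def using A v that by (rule mult_col_mat_nth)
  have "\<chi> (mat_dot n R U Y) = (\<Prod>p\<in>mat_index n. \<chi> (U p \<otimes> Y p))"
    unfolding mat_dot_def
    by (rule character_finsum) (use c in \<open>auto simp: mat_index_def\<close>)
  also have "\<dots> = (\<Prod>i<n. \<Prod>k<n. \<chi> (U (i, k) \<otimes> Y (i, k)))"
    by (simp add: mat_index_def prod.cartesian_product)
  \<comment> \<open>Split off column j, the only one that involves v.\<close>
  also have "\<dots> = (\<Prod>i<n. \<chi> (U (i, j) \<otimes> Y (i, j)) *
      (\<Prod>k\<in>{..<n} - {j}. \<chi> (U (i, k) \<otimes> Y (i, k))))"
    by (rule prod.cong[OF refl], rule prod.remove) (use j in auto)
  also have "\<dots> = (\<Prod>i<n. \<chi> (U (i, j) \<otimes> Y (i, j))) *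
      (\<Prod>i<n. \<Prod>k\<in>{..<n} - {j}. \<chi> (U (i, k) \<otimes> A (i, k)))"
    by (simp add: prod.distrib nth)
  also have "(\<Prod>i<n. \<chi> (U (i, j) \<otimes> Y (i, j))) =
      (\<Prod>i<n. \<Prod>l<n. \<chi> (U (i, j) \<otimes> A (i, l) \<otimes> v l))"
  proof (rule prod.cong[OF refl])
    fix i assume "i \<in> {..<n}"
    then have i: "i < n" by simp
    have "U (i, j) \<otimes> Y (i, j) = (\<Oplus>l\<in>{..<n}. U (i, j) \<otimes> (A (i, l) \<otimes> v l))"
      unfolding nth[OF i j] using i j c v by (simp add: finsum_rdistr Pi_def)
    then have "\<chi> (U (i, j) \<otimes> Y (i, j)) = (\<Prod>l<n. \<chi> (U (i, j) \<otimes> (A (i, l) \<otimes> v l)))"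
      using i j c v by (subst character_finsum[symmetric]) auto
    then show "\<chi> (U (i, j) \<otimes> Y (i, j)) = (\<Prod>l<n. \<chi> (U (i, j) \<otimes> A (i, l) \<otimes> v l))"
      using i j c v by (simp add: m_assoc)
  qed
  \<comment> \<open>Exchanging the products collects, for each l, all terms containing
    \<open>v l\<close>, so that they merge into one coefficient.\<close>
  also have "\<dots> = (\<Prod>l<n. \<Prod>i<n. \<chi> (U (i, j) \<otimes> A (i, l) \<otimes> v l))"
    by (rule prod.swap)
  also have "\<dots> = (\<Prod>l<n. \<chi> ((\<Oplus>i\<in>{..<n}. U (i, j) \<otimes> A (i, l)) \<otimes> v l))"
  proof (rule prod.cong[OF refl])
    fix l assume "l \<in> {..<n}"
    then have l: "l < n" by simp
    have "(\<Oplus>i\<in>{..<n}. U (i, j) \<otimes> A (i, l)) \<otimes> v l = (\<Oplus>i\<in>{..<n}. U (i, j) \<otimes> A (i, l) \<otimes> v l)"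
      by (rule finsum_ldistr) (use l j c v in auto)
    then show "(\<Prod>i<n. \<chi> (U (i, j) \<otimes> A (i, l) \<otimes> v l)) =
        \<chi> ((\<Oplus>i\<in>{..<n}. U (i, j) \<otimes> A (i, l)) \<otimes> v l)"
      using l j c v by (subst character_finsum[symmetric]) auto
  qed
  finally show ?thesis
    by (simp add: Y_def mult.commute)
qed

end

section \<open>Counting matrices with orthogonality conditions on their columns\<close>

text \<open>The entries (i, l), l distinct from j, are determined by the remaining entries of A.\<close>

lemma (in field) card_mats_orthogonal_columns:
  assumes fin: "finite (carrier R)" and u: "\<And>i. i < n \<Longrightarrow> u i \<in> carrier R"
    and i: "i < n" "u i \<noteq> \<zero>" and j: "j < n"
  shows "card {A \<in> carrier (mat_ring n R).
      \<forall>l<n. l \<noteq> j \<longrightarrow> (\<Oplus>k\<in>{..<n}. u k \<otimes> A (k, l)) = \<zero>} \<le> card (carrier R) ^ (n\<^sup>2 - n + 1)"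
    (is "card ?M \<le> _")
proof -
  \<comment> \<open>One position for each linear equation, taken in row i, where the coefficient
    \<open>u i\<close> can be inverted.\<close>
  define D where "D = {i} \<times> ({..<n} - {j})"
  define I where "I = mat_index n - D"
  have D: "D \<subseteq> mat_index n" "card D = n - 1"
    using i j by (auto simp: D_def mat_index_def)
  have "card I = n * n - (n - 1)"
    unfolding I_def using D by (subst card_Diff_subset) (auto simp: mat_index_def intro: finite_subset)
  \<comment> \<open>With truncated subtraction this rewriting relies on 1 <= n <= n^2; n >= 1 comes
    from i < n.\<close>
  then have card_I: "card I = n\<^sup>2 - n + 1"
    using i by (simp add: power2_eq_square Suc_diff_le le_square)
  have fin_I: "finite I"
    by (simp add: I_def finite_mat_index)
  have "inj_on (\<lambda>A. restrict A I) ?M"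
  proof (rule inj_onI)
    fix A Y assume A: "A \<in> ?M" and Y: "Y \<in> ?M" and eq: "restrict A I = restrict Y I"
    then have cl: "A \<in> carrier (mat_ring n R)" "Y \<in> carrier (mat_ring n R)" by auto
    note c = mat_carrierD[OF cl(1)] mat_carrierD[OF cl(2)]
    have eq: "A p = Y p" if "p \<in> I" for p
      using eq that by (metis restrict_apply')
    show "A = Y"
    proof (rule mat_eqI[OF cl])
      fix k l assume kl: "k < n" "l < n"
      show "A (k, l) = Y (k, l)"
      proof (cases "(k, l) \<in> I")
        case True
        then show ?thesis by (rule eq)
      next
        case False
        then have "k = i" "l \<noteq> j"
          using kl by (auto simp: I_def D_def mat_index_def)
        \<comment> \<open>The part of the equation for column l that avoids row i. Its positions lie
          in I, so it agrees for A and Y, and cancelling first r and then \<open>u i\<close>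
          identifies the entries at (i, l).\<close>
        define r where "r = (\<Oplus>k\<in>{..<n} - {i}. u k \<otimes> A (k, l))"
        have r: "r = (\<Oplus>k\<in>{..<n} - {i}. u k \<otimes> Y (k, l))"
          unfolding r_def
          by (rule finsum_cong') (use kl u c eq in \<open>auto simp: I_def D_def mat_index_def\<close>)
        have ins: "insert i ({..<n} - {i}) = {..<n}"
          using i by auto
        have split: "(\<Oplus>k\<in>{..<n}. u k \<otimes> Z (k, l)) =
            u i \<otimes> Z (i, l) \<oplus> (\<Oplus>k\<in>{..<n} - {i}. u k \<otimes> Z (k, l))"
          if "Z \<in> carrier (mat_ring n R)" for Z
          using finsum_insert[of "{..<n} - {i}" i "\<lambda>k. u k \<otimes> Z (k, l)"]
            mat_carrierD[OF that] u i kl by (simp add: ins Pi_def del: insert_Diff_single)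
        have "r \<in> carrier R"
          unfolding r_def using u c kl by (auto intro!: finsum_closed)
        moreover have "u i \<otimes> A (i, l) \<oplus> r = u i \<otimes> Y (i, l) \<oplus> r"
          using A Y kl \<open>l \<noteq> j\<close> split[OF cl(1)] split[OF cl(2)] by (simp add: r[symmetric] r_def[symmetric])
        ultimately have "u i \<otimes> A (i, l) = u i \<otimes> Y (i, l)"
          using u c i kl by (simp add: add.r_cancel)
        then show ?thesis
          using u c i kl m_lcancel \<open>k = i\<close> by metis
      qed
    qed
  qed
  moreover have "(\<lambda>A. restrict A I) ` ?M \<subseteq> I \<rightarrow>\<^sub>E carrier R"
    by (auto simp: I_def mat_ring_def)
  ultimately have "card ?M \<le> card (I \<rightarrow>\<^sub>E carrier R)"
    using fin fin_I by (intro card_inj_on_le) (auto intro!: finite_PiE)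
  then show ?thesis
    using fin_I card_I by (simp add: card_PiE)
qed

section \<open>The explicit bound for the Gauss sum\<close>

text \<open>Comparing |T| = (q - 1) q^(n-1) with at most q^(n^2-n+1) surviving matrices, each
  contributing q^(n-1), gives the bound q / (q - 1) times q^(n^2-n).\<close>

lemma (in finite_field_character) norm_GL_gauss_sum_le:
  assumes U: "U \<in> carrier (mat_ring n R)" and U0: "U \<noteq> \<zero>\<^bsub>mat_ring n R\<^esub>"
  shows "norm (GL_gauss_sum n R U \<chi>) \<le> 2 * real (card (carrier R)) ^ (n\<^sup>2 - n)"
proof -
  define q where "q = card (carrier R)"
  have "\<exists>i j. i < n \<and> j < n \<and> U (i, j) \<noteq> \<zero>"
  proof (rule ccontr)
    assume "\<not> ?thesis"
    then have "U = \<zero>\<^bsub>mat_ring n R\<^esub>"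
      using U by (intro mat_eqI[OF U]) (auto simp: mat_ring_def mat_index_def)
    with U0 show False by simp
  qed
  then obtain i j where i: "i < n" and j: "j < n" and ij: "U (i, j) \<noteq> \<zero>"
    by auto
  note cU = mat_carrierD[OF U]
  define w where "w = (\<lambda>A (l::nat). \<Oplus>k\<in>{..<n}. U (k, j) \<otimes> A (k, l))"
  \<comment> \<open>The replacement columns v with nonzero j-th entry, for which
    \<open>col_mat n R j v\<close> is invertible.\<close>
  define T where "T = (\<Pi>\<^sub>E l\<in>{..<n}. if l = j then carrier R - {\<zero>} else carrier R)"
  \<comment> \<open>Invertibility is dropped here: M contains every A in \<open>GL n R\<close> with
    a nonvanishing inner sum, and is counted by linear equations alone.\<close>
  define M where "M = {A \<in> carrier (mat_ring n R). \<forall>l<n. l \<noteq> j \<longrightarrow> w A l = \<zero>}"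
  have q: "q \<ge> 2"
    using card_mono[of "carrier R" "{\<zero>, \<one>}"] finite_carrier by (simp add: q_def)
  have "card T = (\<Prod>l<n. card (if l = j then carrier R - {\<zero>} else carrier R))"
    unfolding T_def by (rule card_PiE) simp
  also have "\<dots> = (q - 1) * q ^ (n - 1)"
    using j finite_carrier by (subst prod.remove[of _ j]) (auto simp: q_def)
  finally have card_T: "card T = (q - 1) * q ^ (n - 1)" .
  have T: "v l \<in> carrier R" if "v \<in> T" "l < n" for v l
    using PiE_mem[OF that(1)[unfolded T_def], of l] that by (auto split: if_splits)
  have Tj: "v j \<noteq> \<zero>" if "v \<in> T" for v
    using PiE_mem[OF that[unfolded T_def], of j] j by auto
  have GL: "A \<in> carrier (mat_ring n R)" if "A \<in> GL n R" for A
    using that by (auto simp: GL_def Units_def)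
  have fin_GL: "finite (GL n R)"
    by (rule finite_subset[OF _ finite_mat_carrier[OF finite_carrier]]) (use GL in auto)
  have inner: "norm (\<Sum>v\<in>T. \<chi> (mat_dot n R U (A \<otimes>\<^bsub>mat_ring n R\<^esub> col_mat n R j v))) =
      (if A \<in> M then real q ^ (n - 1) else 0)" if "A \<in> GL n R" for A
  proof -
    note A = GL[OF that]
    note cX = mat_carrierD[OF A]
    \<comment> \<open>The contribution of the columns other than j, independent of v and of modulus
      1, hence invisible in the norm.\<close>
    define c where "c = (\<Prod>i<n. \<Prod>k\<in>{..<n} - {j}. \<chi> (U (i, k) \<otimes> A (i, k)))"
    have "norm c = 1"
      by (simp add: c_def prod_norm[symmetric] norm_character cU cX)
    have "(\<Sum>v\<in>T. \<chi> (mat_dot n R U (A \<otimes>\<^bsub>mat_ring n R\<^esub> col_mat n R j v))) =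
        c * (\<Sum>v\<in>T. \<Prod>l<n. \<chi> (w A l \<otimes> v l))"
      unfolding sum_distrib_left c_def w_def
      by (intro sum.cong refl character_mat_dot_mult_col_mat U A j T)
    moreover have "norm (\<Sum>v\<in>T. \<Prod>l<n. \<chi> (w A l \<otimes> v l)) =
        (if \<forall>l<n. l \<noteq> j \<longrightarrow> w A l = \<zero> then real q ^ (n - 1) else 0)"
      unfolding T_def q_def
    proof (rule norm_sum_character_vec)
      show "w A l \<in> carrier R" if "l < n" for l
        using that cU cX j by (auto simp: w_def intro!: finsum_closed)
      show "\<exists>l<n. w A l \<noteq> \<zero>"
        unfolding w_def using GL_vec_mult_nonzero[OF \<open>A \<in> GL n R\<close>, of "\<lambda>k. U (k, j)" i] cU i j ij
        by blast
    qed (rule j)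
    ultimately show ?thesis
      using \<open>norm c = 1\<close> A by (simp add: norm_mult M_def)
  qed
  \<comment> \<open>Averaging: every v in T yields the same Gauss sum after translation, and
    exchanging the sums leaves the inner sum over v for fixed A.\<close>
  have "of_nat (card T) * GL_gauss_sum n R U \<chi> = (\<Sum>v\<in>T. GL_gauss_sum n R U \<chi>)"
    by simp
  also have "\<dots> = (\<Sum>v\<in>T. \<Sum>A\<in>GL n R. \<chi> (mat_dot n R U (A \<otimes>\<^bsub>mat_ring n R\<^esub> col_mat n R j v)))"
  proof (rule sum.cong[OF refl])
    fix v assume "v \<in> T"
    then have "col_mat n R j v \<in> Units (mat_ring n R)"
      using col_mat_GL[of n v j] T Tj j by (simp add: GL_def)
    then show "GL_gauss_sum n R U \<chi> =
        (\<Sum>A\<in>GL n R. \<chi> (mat_dot n R U (A \<otimes>\<^bsub>mat_ring n R\<^esub> col_mat n R j v)))"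
      unfolding GL_gauss_sum_def GL_def
      by (rule monoid.sum_Units_mult_right[OF mat_monoid, symmetric])
  qed
  also have "\<dots> = (\<Sum>A\<in>GL n R. \<Sum>v\<in>T. \<chi> (mat_dot n R U (A \<otimes>\<^bsub>mat_ring n R\<^esub> col_mat n R j v)))"
    by (rule sum.swap)
  finally have "real (card T) * norm (GL_gauss_sum n R U \<chi>) =
      norm (\<Sum>A\<in>GL n R. \<Sum>v\<in>T. \<chi> (mat_dot n R U (A \<otimes>\<^bsub>mat_ring n R\<^esub> col_mat n R j v)))"
    by (metis norm_mult norm_of_nat)
  also have "\<dots> \<le> (\<Sum>A\<in>GL n R. if A \<in> M then real q ^ (n - 1) else 0)"
    by (rule order.trans[OF norm_sum]) (simp add: inner)
  also have "\<dots> = real (card (GL n R \<inter> M)) * real q ^ (n - 1)"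
    using fin_GL by (simp add: sum.If_cases)
  also have "\<dots> \<le> real (q ^ (n\<^sup>2 - n + 1)) * real q ^ (n - 1)"
  proof (intro mult_right_mono of_nat_mono)
    have "card (GL n R \<inter> M) \<le> card M"
      using finite_mat_carrier[OF finite_carrier] by (intro card_mono) (auto simp: M_def)
    also have "\<dots> \<le> q ^ (n\<^sup>2 - n + 1)"
      unfolding M_def w_def q_def
      by (rule card_mats_orthogonal_columns[where i = i]) (use finite_carrier cU i j ij in auto)
    finally show "card (GL n R \<inter> M) \<le> q ^ (n\<^sup>2 - n + 1)" .
  qed simp
  \<comment> \<open>The common factor q^(n-1) cancels, and one q is split off from
    q^(n^2-n+1).\<close>
  finally have "(real q - 1) * norm (GL_gauss_sum n R U \<chi>) \<le> real q * real q ^ (n\<^sup>2 - n)"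
    using q by (simp add: card_T of_nat_diff mult_ac)
  \<comment> \<open>The constant 2 arises here: q <= 2 (q - 1) because q >= 2.\<close>
  also have "\<dots> \<le> (real q - 1) * (2 * real q ^ (n\<^sup>2 - n))"
    using mult_right_mono[of "real q" "2 * (real q - 1)" "real q ^ (n\<^sup>2 - n)"] q
    by (simp add: mult_ac)
  finally show ?thesis
    using q by (simp add: q_def)
qed

theorem corollary2p2:
  fixes n :: nat
  assumes "n \<ge> 1"
  shows "\<exists>C::real. C > 0 \<and>
    (\<forall>(F :: 'a ring) U \<chi>.
      field F \<longrightarrow> finite (carrier F) \<longrightarrow>
      U \<in> carrier (mat_ring n F) \<longrightarrow> U \<noteq> \<zero>\<^bsub>mat_ring n F\<^esub> \<longrightarrow>
      additive_character F \<chi> \<longrightarrow> nontrivial_character F \<chi> \<longrightarrow>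
      norm (GL_gauss_sum n F U \<chi>) \<le> C * real (card (carrier F)) ^ (n\<^sup>2 - n))"
\<comment> \<open>The witness 2 bounds q / (q - 1) for every field, so it can be fixed before F, U
  and the character.\<close>
proof (intro exI[of _ 2] conjI allI impI)
  fix F :: "'a ring" and U \<chi>
  assume "field F" "finite (carrier F)" "additive_character F \<chi>" "nontrivial_character F \<chi>"
  then interpret finite_field_character F \<chi>
    by (simp add: finite_field_character_def finite_field_character_axioms_def)
  assume "U \<in> carrier (mat_ring n F)" "U \<noteq> \<zero>\<^bsub>mat_ring n F\<^esub>"
  then show "norm (GL_gauss_sum n F U \<chi>) \<le> 2 * real (card (carrier F)) ^ (n\<^sup>2 - n)"
    by (rule norm_GL_gauss_sum_le)
qed simp

end
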